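(* Let $\mathcal{A}$ be a Boolean tensor of size $I_1\times\cdots\times I_M\times J_1\times\cdots\times J_N$ with Boolean rank $r_b(\mathcal{A})\leq 1$. Then $\mathcal{A}$ is regular.
   Context: A Boolean tensor is an array with entries in $\{0,1\}$; entries are added and multiplied by the rules of the binary Boolean algebra ($1+1=1$, otherwise as usual). For $\mathcal{A}$ of size $I_1\times\cdots\times I_M\times J_1\times\cdots\times J_N$ and $\mathcal{B}$ of size $J_1\times\cdots\times J_N\times K_1\times\cdots\times K_L$, the Einstein product $\mathcal{A}*_N\mathcal{B}$ has entries $\sum_{j_1,\dots,j_N}a_{i_1\ldots i_Mj_1\ldots j_N}b_{j_1\ldots j_Nk_1\ldots k_L}$ (Boolean sum); the subscript of $*$ is the number of contracted indices. The Boolean rank $r_b(\mathcal{A})$ of a nonzero Boolean tensor $\mathcal{A}$ is the least positive integer $r=K_1\times\cdots\times K_L$ (product of integers) for which there exist Boolean tensors $\mathcal{B}$ of size $I_1\times\cdots\times I_M\times K_1\times\cdots\times K_L$ and $\mathcal{C}$ of size $K_1\times\cdots\times K_L\times J_1\times\cdots\times J_N$ with $\mathcal{A}=\mathcal{B}*_L\mathcal{C}$; the zero tensor has Boolean rank $0$. $\mathcal{A}$ is regular if there is a Boolean tensor $\mathcal{X}$ of size $J_1\times\cdots\times J_N\times I_1\times\cdots\times I_M$ with $\mathcal{A}*_N\mathcal{X}*_M\mathcal{A}=\mathcal{A}$. *)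

theory Defs
  imports "HOL-Library.FuncSet"
begin

text \<open>
  Boolean entries are of type \<^typ>\<open>bool\<close>: 0 is \<^term>\<open>False\<close>, 1 is \<^term>\<open>True\<close>, the Boolean
  product is \<open>\<and>\<close>, and the Boolean sum (with 1 + 1 = 1) is \<open>\<or>\<close>, so that a Boolean sum over an
  index set is a bounded existential quantifier.

  A size is the list \<open>[I\<^sub>1, \<dots>, I\<^sub>M]\<close> of its dimensions, and a multi-index is a list of the same
  length with 1-based components. The size \<open>I\<^sub>1 \<times> \<dots> \<times> I\<^sub>M \<times> J\<^sub>1 \<times> \<dots> \<times> J\<^sub>N\<close> is \<open>Is @ Js\<close>; where the
  block structure matters, \<open>Is\<close> and \<open>Js\<close> are passed separately.
\<close>

definition tensor_size :: "nat list \<Rightarrow> bool" where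
  "tensor_size ds \<longleftrightarrow> ds \<noteq> [] \<and> (\<forall>d\<in>set ds. 0 < d)"

definition indices :: "nat list \<Rightarrow> nat list set" where
  "indices ds = {is. list_all2 (\<lambda>i d. 1 \<le> i \<and> i \<le> d) is ds}"

text \<open>
  Tensors are extensional on their index set, so that HOL equality of two tensors of the same
  size is equality of all their entries.
\<close>

definition boolean_tensors :: "nat list \<Rightarrow> (nat list \<Rightarrow> bool) set" where
  "boolean_tensors ds = indices ds \<rightarrow>\<^sub>E UNIV"

definition zero_tensor :: "nat list \<Rightarrow> nat list \<Rightarrow> bool" where
  "zero_tensor ds = (\<lambda>_\<in>indices ds. False)"

text \<open>
  The Einstein product of \<open>A\<close> of size \<open>Is @ Js\<close> and \<open>B\<close> of size \<open>Js @ Ks\<close>, contracting all of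
  \<open>Js\<close>. An index \<open>l\<close> of the result is split as \<open>i @ k\<close> with \<open>i\<close> in \<open>indices Is\<close> and \<open>k\<close> in
  \<open>indices Ks\<close>.
\<close>

definition einstein_product ::
  "nat list \<Rightarrow> nat list \<Rightarrow> nat list \<Rightarrow> (nat list \<Rightarrow> bool) \<Rightarrow> (nat list \<Rightarrow> bool) \<Rightarrow> nat list \<Rightarrow> bool" where
  "einstein_product Is Js Ks A B =
     (\<lambda>l\<in>indices (Is @ Ks).
        \<exists>j\<in>indices Js. A (take (length Is) l @ j) \<and> B (j @ drop (length Is) l))"

definition boolean_rank :: "nat list \<Rightarrow> nat list \<Rightarrow> (nat list \<Rightarrow> bool) \<Rightarrow> nat" where
  "boolean_rank Is Js A =
     (if A = zero_tensor (Is @ Js) then 0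
      else (LEAST r. 0 < r \<and>
              (\<exists>Ks B C. tensor_size Ks \<and> r = prod_list Ks \<and>
                 B \<in> boolean_tensors (Is @ Ks) \<and> C \<in> boolean_tensors (Ks @ Js) \<and>
                 A = einstein_product Is Ks Js B C)))"

definition regular_tensor :: "nat list \<Rightarrow> nat list \<Rightarrow> (nat list \<Rightarrow> bool) \<Rightarrow> bool" where
  "regular_tensor Is Js A \<longleftrightarrow>
     (\<exists>X\<in>boolean_tensors (Js @ Is).
        einstein_product Is Is Js (einstein_product Is Js Is A X) A = A)"

end

theory Submission
  imports Defs
begin

text \<open>
  View a tensor as a relation between row indices and column indices. A nonzero tensor of Boolean
  rank at most 1 is the outer product of a set of rows and a set of columns: the contracted index of a
  factorization of size 1 takes a single value \<open>k\<close>, so the entry at \<open>(i, j)\<close> is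
  \<open>b\<^sub>i\<^sub>k \<and> c\<^sub>k\<^sub>j\<close>. Hence its support is a rectangle: with \<open>(i, j')\<close> and \<open>(i', j)\<close> it contains
  \<open>(i, j)\<close> (\<open>rectangular_of_rank_le_1\<close>). The zero tensor has the empty rectangle as support.

  For such a tensor the transpose is a generalized inverse. An entry 1 at \<open>(i, j)\<close> is recovered by
  the walk \<open>i, j, i, j\<close>, whatever the tensor is. Conversely, a 1 of the triple product at
  \<open>(i, j)\<close> comes from a walk \<open>i, j', i', j\<close>, whose first and last steps put \<open>(i, j)\<close> in the
  rectangle (\<open>regular_of_rectangular\<close>).
\<close>

lemma indices_length: "i \<in> indices Is \<Longrightarrow> length i = length Is"
  by (auto simp: indices_def dest: list_all2_lengthD)

lemma append_in_indices: "i \<in> indices Is \<Longrightarrow> j \<in> indices Js \<Longrightarrow> i @ j \<in> indices (Is @ Js)"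
  by (auto simp: indices_def intro: list_all2_appendI)

lemma indices_appendE:
  assumes "l \<in> indices (Is @ Js)"
  obtains i j where "l = i @ j" "i \<in> indices Is" "j \<in> indices Js"
  using assms by (auto simp: indices_def list_all2_append2)

lemma einstein_product_entry:
  assumes "i \<in> indices Is" and "k \<in> indices Ks"
  shows "einstein_product Is Js Ks A B (i @ k) \<longleftrightarrow> (\<exists>j\<in>indices Js. A (i @ j) \<and> B (j @ k))"
  using assms by (simp add: einstein_product_def append_in_indices indices_length)

lemma einstein_product_in_boolean_tensors:
  "einstein_product Is Js Ks A B \<in> boolean_tensors (Is @ Ks)"
  by (simp add: einstein_product_def boolean_tensors_def)

lemma boolean_tensor_eqI:
  assumes "A \<in> boolean_tensors (Is @ Js)" and "B \<in> boolean_tensors (Is @ Js)"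
    and "\<And>i j. i \<in> indices Is \<Longrightarrow> j \<in> indices Js \<Longrightarrow> A (i @ j) = B (i @ j)"
  shows "A = B"
proof (rule PiE_ext[OF assms(1,2)[unfolded boolean_tensors_def]])
  fix l assume "l \<in> indices (Is @ Js)"
  then show "A l = B l"
    by (rule indices_appendE) (simp add: assms(3))
qed

text \<open>
  The rank is a least element, so it says something only once some factorization exists. The
  unit tensor as a left factor provides one.
\<close>

lemma ex_factorization:
  assumes "A \<in> boolean_tensors (Is @ Js)"
  shows "\<exists>B\<in>boolean_tensors (Is @ Is). A = einstein_product Is Is Js B A"
proof
  let ?E = "\<lambda>l\<in>indices (Is @ Is). take (length Is) l = drop (length Is) l"
  show "?E \<in> boolean_tensors (Is @ Is)"
    by (simp add: boolean_tensors_def)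
  show "A = einstein_product Is Is Js ?E A"
  proof (rule boolean_tensor_eqI[OF assms einstein_product_in_boolean_tensors])
    fix i j assume "i \<in> indices Is" "j \<in> indices Js"
    then show "A (i @ j) = einstein_product Is Is Js ?E A (i @ j)"
      by (auto simp: einstein_product_entry append_in_indices indices_length)
  qed
qed

lemma boolean_rank_factorization:
  assumes "tensor_size Is" and "A \<in> boolean_tensors (Is @ Js)" and "A \<noteq> zero_tensor (Is @ Js)"
  obtains Ks B C where "0 < boolean_rank Is Js A" "prod_list Ks = boolean_rank Is Js A"
    "A = einstein_product Is Ks Js B C"
proof -
  let ?P = "\<lambda>r. 0 < r \<and> (\<exists>Ks B C. tensor_size Ks \<and> r = prod_list Ks \<and>
     B \<in> boolean_tensors (Is @ Ks) \<and> C \<in> boolean_tensors (Ks @ Js) \<and>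
     A = einstein_product Is Ks Js B C)"
  have "0 < prod_list Is"
    using assms(1) by (auto simp: tensor_size_def prod_list_zero_iff intro!: gr0I)
  then have "?P (prod_list Is)"
    using ex_factorization[OF assms(2)] assms(1,2) by blast
  then have "?P (LEAST r. ?P r)"
    by (rule LeastI)
  then have "?P (boolean_rank Is Js A)"
    using assms(3) by (simp add: boolean_rank_def)
  with that show thesis
    by metis
qed

lemma indices_unique_of_prod_list_1:
  assumes "prod_list Ks = 1" and "k \<in> indices Ks" and "k' \<in> indices Ks"
  shows "k = k'"
proof -
  have "k = replicate (length Ks) 1" if "k \<in> indices Ks" for k
    using that assms(1) unfolding indices_def mem_Collect_eq
    by (induction k Ks rule: list_all2_induct) auto
  from this[OF assms(2)] this[OF assms(3)] show ?thesis
    by simp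
qed

text \<open>
  The support of an outer product is a rectangle: \<open>b\<^sub>i\<close> can be read off from any 1 in row \<open>i\<close>,
  and \<open>c\<^sub>j\<close> from any 1 in column \<open>j\<close>.
\<close>

lemma rectangular_of_rank_le_1:
  assumes "tensor_size Is" and "A \<in> boolean_tensors (Is @ Js)" and "boolean_rank Is Js A \<le> 1"
    and i: "i \<in> indices Is" and i': "i' \<in> indices Is"
    and j: "j \<in> indices Js" and j': "j' \<in> indices Js"
    and "A (i @ j')" and "A (i' @ j)"
  shows "A (i @ j)"
proof -
  have "A \<noteq> zero_tensor (Is @ Js)"
    using \<open>A (i @ j')\<close> i j' by (auto simp: zero_tensor_def append_in_indices)
  with assms(1,2) obtain Ks B C
    where pos: "0 < boolean_rank Is Js A" and rank: "prod_list Ks = boolean_rank Is Js A"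
      and A: "A = einstein_product Is Ks Js B C"
    by (rule boolean_rank_factorization)
  have "prod_list Ks = 1"
    using pos rank assms(3) by simp
  obtain k where k: "k \<in> indices Ks" "B (i @ k)"
    using \<open>A (i @ j')\<close> i j' unfolding A by (auto simp: einstein_product_entry)
  obtain k' where k': "k' \<in> indices Ks" "C (k' @ j)"
    using \<open>A (i' @ j)\<close> i' j unfolding A by (auto simp: einstein_product_entry)
  have "k' = k"
    using \<open>prod_list Ks = 1\<close> k'(1) k(1) by (rule indices_unique_of_prod_list_1)
  then show ?thesis
    using k k' i j unfolding A by (auto simp: einstein_product_entry)
qed

text \<open>
  The generalized inverse is the transpose: every 1 of the triple product ends a walk through the
  support whose outer two steps lie in row \<open>i\<close> and column \<open>j\<close>, so the rectangle property applies.
\<close>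

lemma regular_of_rectangular:
  assumes A: "A \<in> boolean_tensors (Is @ Js)"
    and rect: "\<And>i i' j j'. i \<in> indices Is \<Longrightarrow> i' \<in> indices Is \<Longrightarrow> j \<in> indices Js \<Longrightarrow>
      j' \<in> indices Js \<Longrightarrow> A (i @ j') \<Longrightarrow> A (i' @ j) \<Longrightarrow> A (i @ j)"
  shows "regular_tensor Is Js A"
  unfolding regular_tensor_def
proof
  let ?X = "\<lambda>l\<in>indices (Js @ Is). A (drop (length Js) l @ take (length Js) l)"
  show "?X \<in> boolean_tensors (Js @ Is)"
    by (simp add: boolean_tensors_def)
  have X: "?X (j @ i) = A (i @ j)" if "i \<in> indices Is" "j \<in> indices Js" for i j
    using that by (simp add: append_in_indices indices_length)
  show "einstein_product Is Is Js (einstein_product Is Js Is A ?X) A = A" (is "?P = A")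
  proof (rule boolean_tensor_eqI[OF einstein_product_in_boolean_tensors A])
    fix i j assume i: "i \<in> indices Is" and j: "j \<in> indices Js"
    have "?P (i @ j) \<longleftrightarrow>
        (\<exists>i'\<in>indices Is. (\<exists>j'\<in>indices Js. A (i @ j') \<and> A (i' @ j')) \<and> A (i' @ j))"
      using i j by (simp only: einstein_product_entry X cong: bex_cong)
    also have "\<dots> \<longleftrightarrow> A (i @ j)"
      using i j rect by blast
    finally show "?P (i @ j) = A (i @ j)" .
  qed
qed

theorem theorem3p46:
  fixes Is Js :: "nat list" and A :: "nat list \<Rightarrow> bool"
  assumes "tensor_size Is" and "tensor_size Js"
    and "A \<in> boolean_tensors (Is @ Js)"
    and "boolean_rank Is Js A \<le> 1"
  shows "regular_tensor Is Js A"
  using assms(3) rectangular_of_rank_le_1[OF assms(1,3,4)]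
  by (rule regular_of_rectangular)

end
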